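(* Let $n\in\{2,3,4\}$. Let $v_1,\ldots,v_n\in\mathbb{R}$ and $(\bar{x}_1,\ldots,\bar{x}_n)\in(\mathbb{R}/\mathbb{Z})^n$, and let $x_1,\ldots,x_n:[0,\infty)\to\mathbb{R}/\mathbb{Z}$ be the $n$ runners given by $x_j(t)=\{\bar{x}_j+tv_j\}$ for all $t\ge 0$. Then for each $i\in\{1,\ldots,n\}$ the following holds: if the $n-1$ numbers $|v_j-v_i|$, $j\in\{1,\ldots,n\}\setminus\{i\}$, are positive and pairwise distinct, then there is $t>0$ such that $$|x_j(t)-x_i(t)|\in\left[\frac1n,1-\frac1n\right]\qquad\forall j\in\{1,\ldots,n\}\setminus\{i\}.$$
   Context: $\{x\}=x-\lfloor x\rfloor\in[0,1)$ denotes the fractional part of $x\in\mathbb{R}$; elements of $\mathbb{R}/\mathbb{Z}$ are represented by their representatives in $[0,1)$, and $|x_j(t)-x_i(t)|$ is the absolute value of the difference of these real representatives. This property, for a given $n$, is the "Lonely Runner Conjecture with Free Starting Positions" for $n$. *)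

theory Defs
  imports Complex_Main
begin

text \<open>
  Elements of \<open>\<real>/\<int>\<close> are given by their representatives in \<open>[0,1)\<close>, so the position of a runner
  and the difference of two positions are ordinary real numbers.
\<close>

definition runner :: "real \<Rightarrow> real \<Rightarrow> real \<Rightarrow> real" where
  "runner x0 s t = frac (x0 + t * s)"

definition lonely_runner_free_start :: "nat \<Rightarrow> bool" where
  "lonely_runner_free_start n \<longleftrightarrow>
     (\<forall>(v :: nat \<Rightarrow> real) (xbar :: nat \<Rightarrow> real).
        (\<forall>j\<in>{1..n}. xbar j \<in> {0..<1}) \<longrightarrow>
        (\<forall>i\<in>{1..n}.
           (\<forall>j\<in>{1..n} - {i}. 0 < \<bar>v j - v i\<bar>) \<and>
           inj_on (\<lambda>j. \<bar>v j - v i\<bar>) ({1..n} - {i}) \<longrightarrow>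
           (\<exists>t>0. \<forall>j\<in>{1..n} - {i}.
              \<bar>runner (xbar j) (v j) t - runner (xbar i) (v i) t\<bar>
                \<in> {1 / real n .. 1 - 1 / real n})))"

end

theory Submission
  imports Defs
begin

text \<open>
  Subtract the position of runner \<open>i\<close> and add half a turn: the condition on runner \<open>j\<close> becomes
  that its relative phase \<open>x + t * w\<close>, with \<open>w\<close> its relative speed, lies within
  \<open>r = 1/2 - 1/n\<close> of an integer. This condition is symmetric under negation, so the relative speeds
  may be taken positive, and they are then distinct. A time at which all phases are good has to be
  found, where \<open>r\<close> is \<open>0\<close>, \<open>1/6\<close> or \<open>1/4\<close> and there are one, two or three phases.

  The good times of a runner of speed \<open>w\<close> are closed windows of length \<open>2 * r / w\<close>, one per period
  \<open>1 / w\<close>. From one window of speed \<open>a\<close> to the next, the phase of a runner of speed \<open>b\<close> advances by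
  \<open>b / a\<close>, so the question whether some window of \<open>a\<close> overlaps one of \<open>b\<close> in an interval of a given
  length asks whether an orbit of a rotation of the circle meets a given closed arc. It does as soon
  as some iterate of the rotation is a nontrivial rotation by at most the length of the arc
  (\<open>rotation_hits_arc\<close>); this yields \<open>joint_window\<close>, and \<open>two_speeds\<close> follows at once.

  For three speeds \<open>a < b < c\<close> and \<open>r = 1/4\<close>, the bad times of \<open>c\<close> are open intervals of length
  \<open>1 / (2 * c)\<close>. Hence it suffices to find a joint window of \<open>a\<close> and \<open>b\<close> of that length. With
  \<open>\<epsilon> = b / a - 1\<close>, the arc to be hit has length \<open>L = 1 - b / c + \<epsilon> / 2\<close>, which exceeds
  \<open>\<epsilon> / 2\<close>. Taking the number of steps of size \<open>\<epsilon>\<close> that comes closest to a full turn produces an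
  iterate that rotates by at most \<open>\<epsilon> / 2\<close>, so the arc can only be missed when this iterate is
  trivial, that is, when \<open>\<epsilon> = 1 / N\<close>. Now \<open>a = N * u\<close> and \<open>b = (N + 1) * u\<close> have the common period
  \<open>1 / u\<close>. If \<open>c / u\<close> is not an integer, repeating one joint good time of \<open>a\<close> and \<open>b\<close> with that
  period rotates the phase of \<open>c\<close> nontrivially, until it falls in the good half of the circle. If
  \<open>c / u\<close> is an integer, the arc being missed forces \<open>c\<close> to be so close to \<open>b\<close> that only
  \<open>N = 1\<close> and \<open>c = 3 * u\<close> remain. The speeds \<open>u\<close>, \<open>2 * u\<close>, \<open>3 * u\<close> are settled by parity
  (\<open>speeds_one_two_three\<close>).
\<close>

section \<open>Phases close to an integer\<close>

text \<open>
  This is the good arc of radius \<open>r\<close> on the circle; centring it at \<open>0\<close> makes the condition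
  invariant under negation and under integer shifts.
\<close>
definition near_int :: "real \<Rightarrow> real \<Rightarrow> bool" where
  "near_int r x \<longleftrightarrow> (\<exists>z::int. \<bar>x - of_int z\<bar> \<le> r)"

lemma near_intI: "\<bar>x - of_int z\<bar> \<le> r \<Longrightarrow> near_int r x"
  unfolding near_int_def by blast

lemma near_int_add_int: "near_int r (x + of_int m) \<longleftrightarrow> near_int r x"
proof -
  have "near_int r (y + of_int k)" if "near_int r y" for y k
  proof -
    from that obtain z where "\<bar>y - of_int z\<bar> \<le> r" unfolding near_int_def by blast
    then show ?thesis by (intro near_intI[of _ "z + k"]) simp
  qed
  from this[of x m] this[of "x + of_int m" "- m"] show ?thesis by auto
qed

lemma near_int_minus: "near_int r (- x) \<longleftrightarrow> near_int r x"
proof -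
  have "near_int r (- y)" if "near_int r y" for y
  proof -
    from that obtain z where "\<bar>y - of_int z\<bar> \<le> r" unfolding near_int_def by blast
    then show ?thesis by (intro near_intI[of _ "- z"]) simp
  qed
  from this[of x] this[of "- x"] show ?thesis by auto
qed

lemma near_int_abs_speed: 
  assumes "near_int r (sgn w * x + t * \<bar>w\<bar>)" "w \<noteq> 0"
  shows "near_int r (x + t * w)"
proof (cases "w > 0")
  case True
  with assms show ?thesis by simp
next
  case False
  with assms have "near_int r (- (x + t * w))" by simp
  then show ?thesis by (simp only: near_int_minus)
qed

text \<open>
  The bad times of a runner are open intervals of length \<open>(1 - 2 * r) / w\<close>, and a closed interval of at
  least that length does not fit into one of them.
\<close>
lemma near_int_in_long_interval:
  assumes "w > 0" "0 \<le> l" "0 \<le> r" "1 - 2 * r \<le> l * w"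
  shows "\<exists>t\<in>{s..s + l}. near_int r (x + t * w)"
proof -
  define z where "z = \<lceil>x + s * w - r\<rceil>"
  define t where "t = max s ((of_int z - r - x) / w)"
  have z: "of_int z < x + s * w - r + 1" "x + s * w - r \<le> of_int z"
    unfolding z_def by linarith+
  have "(of_int z - r - x) / w \<le> s + l"
    using assms z by (simp add: field_simps)
  then have "t \<in> {s..s + l}" using assms by (auto simp: t_def)
  moreover have "t * w = max (s * w) (of_int z - r - x)"
    using assms by (auto simp: t_def max_def field_simps)
  then have "\<bar>x + t * w - of_int z\<bar> \<le> r" using z assms by linarith
  ultimately show ?thesis using near_intI by blast
qed

section \<open>Rotations of the circle\<close>

text \<open>
  A walk with forward steps no longer than an arc cannot jump over it; the arc is lifted to a
  translate ahead of the starting point.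
\<close>
lemma rotation_hits_arc_pos:
  fixes d :: real
  assumes "0 < d" "d \<le> L"
  shows "\<exists>(k::nat) (z::int). h \<le> p + of_nat k * d - of_int z \<and> p + of_nat k * d - of_int z \<le> h + L"
proof -
  define z where "z = \<lceil>p - h\<rceil>"
  define q where "q = (h + of_int z - p) / d"
  define k where "k = nat \<lceil>q\<rceil>"
  have "p - h \<le> of_int z" unfolding z_def by linarith
  then have "0 \<le> q" using assms by (simp add: q_def)
  then have k: "q \<le> of_nat k" "of_nat k \<le> q + 1" unfolding k_def by linarith+
  have "q * d = h + of_int z - p" using assms by (simp add: q_def)
  moreover have "q * d \<le> of_nat k * d" "of_nat k * d \<le> (q + 1) * d"
    using k assms by (auto intro: mult_right_mono)
  moreover have "(q + 1) * d = q * d + d" by (simp add: algebra_simps)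
  ultimately have "h \<le> p + of_nat k * d - of_int z" "p + of_nat k * d - of_int z \<le> h + L"
    using assms by linarith+
  then show ?thesis by blast
qed

text \<open>
  The \<open>N\<close>-th iterate of the rotation by \<open>\<theta>\<close> is, modulo integers, the rotation by
  \<open>d = N * \<theta> - M\<close>, so that a small nonzero \<open>d\<close> is enough. The choice \<open>N = 0\<close>, \<open>M = - 1\<close> is
  meaningful: it has \<open>d = 1\<close> and covers the arcs that are the whole circle.
\<close>
lemma rotation_hits_arc:
  fixes \<theta> :: real and N :: nat and M :: int
  assumes d: "0 < \<bar>of_nat N * \<theta> - of_int M\<bar>" "\<bar>of_nat N * \<theta> - of_int M\<bar> \<le> L"
  shows "\<exists>(k::nat) (z::int). h \<le> p + of_nat k * \<theta> - of_int z \<and> p + of_nat k * \<theta> - of_int z \<le> h + L"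
proof -
  define d where "d = of_nat N * \<theta> - of_int M"
  have "\<exists>(k::nat) (z::int). h \<le> p + of_nat k * d - of_int z \<and> p + of_nat k * d - of_int z \<le> h + L"
  \<comment> \<open>Backward steps are forward steps of the mirror image.\<close>
  proof (cases "d > 0")
    case True
    then show ?thesis using rotation_hits_arc_pos[of d L h p] assms by (simp add: d_def)
  next
    case False
    then obtain k :: nat and z :: int where
      "- h - L \<le> - p + of_nat k * (- d) - of_int z" 
      "- p + of_nat k * (- d) - of_int z \<le> - h - L + L"
      using rotation_hits_arc_pos[of "- d" L "- h - L" "- p"] assms by (auto simp: d_def)
    then show ?thesis by (intro exI[of _ k] exI[of _ "- z"]) simp
  qed
  then obtain k :: nat and z :: int where
    "h \<le> p + of_nat k * d - of_int z" "p + of_nat k * d - of_int z \<le> h + L" by blast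
  then show ?thesis
    by (intro exI[of _ "k * N"] exI[of _ "z + int k * M"]) (simp add: d_def algebra_simps)
qed

text \<open>
  A rotation by a non-integer \<open>\<theta>\<close> satisfies the hypothesis of \<open>rotation_hits_arc\<close> for every arc
  of at least half a turn; the factor \<open>of_nat 1\<close> matches the form needed there.
\<close>
lemma nonint_rotation_step:
  fixes \<theta> :: real
  assumes "\<theta> \<notin> \<int>"
  shows "0 < \<bar>of_nat 1 * \<theta> - of_int (round \<theta>)\<bar>" "\<bar>of_nat 1 * \<theta> - of_int (round \<theta>)\<bar> \<le> 1 / 2"
proof -
  have "\<theta> \<noteq> of_int (round \<theta>)" using assms by (metis Ints_of_int)
  then show "0 < \<bar>of_nat 1 * \<theta> - of_int (round \<theta>)\<bar>" by simp
  show "\<bar>of_nat 1 * \<theta> - of_int (round \<theta>)\<bar> \<le> 1 / 2"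
    using of_int_round_abs_le[of \<theta>] by (simp add: abs_minus_commute)
qed

section \<open>Windows in which two runners are good\<close>

lemma periodic_windows:
  assumes "0 < a" "0 \<le> r"
  obtains s where "0 < s"
    "\<And>(k::nat) t. t \<in> {s + of_nat k / a .. s + of_nat k / a + 2 * r / a} \<Longrightarrow> near_int r (x + t * a)"
proof -
  define m where "m = \<lceil>x + r\<rceil> + 1"
  define s where "s = (of_int m - r - x) / a"
  have "of_int m - r - x > 0" unfolding m_def by linarith
  then have "0 < s" using assms by (simp add: s_def)
  moreover have "near_int r (x + t * a)"
    if "t \<in> {s + of_nat k / a .. s + of_nat k / a + 2 * r / a}" for k :: nat and t
  proof -
    have "s * a + of_nat k \<le> t * a" "t * a \<le> s * a + of_nat k + 2 * r"
      using that assms by (auto simp: field_simps)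
    moreover have "s * a = of_int m - r - x" using assms by (simp add: s_def)
    ultimately show ?thesis
      by (intro near_intI[of _ "m + int k"]) simp
  qed
  ultimately show ?thesis using that by blast
qed

text \<open>
  Within the time interval \<open>{s..s + A}\<close> the phase of speed \<open>b\<close> sweeps an interval of length \<open>A * b\<close>. The
  last two hypotheses say that this interval neither ends too early nor starts too late to meet the
  good arc around \<open>z\<close> in length \<open>l * b\<close>.
\<close>
lemma window_overlap:
  assumes "0 < b" "0 \<le> l" "l \<le> A" "l * b \<le> 2 * r"
    and "- r - A * b + l * b \<le> y + s * b - of_int z" "y + s * b - of_int z \<le> r - l * b"
  shows "\<exists>s'\<ge>s. s' + l \<le> s + A \<and> (\<forall>t\<in>{s'..s' + l}. near_int r (y + t * b))"
proof -
  define s' where "s' = max s ((of_int z - r - y) / b)"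
  have "(of_int z - r - y) / b + l \<le> s + A"
    using assms by (simp add: field_simps)
  then have "s' + l \<le> s + A" using assms by (auto simp: s'_def)
  moreover have s'b: "s' * b = max (s * b) (of_int z - r - y)"
    using assms by (auto simp: s'_def max_def field_simps)
  have "near_int r (y + t * b)" if "t \<in> {s'..s' + l}" for t
  proof -
    have "s' * b \<le> t * b" "t * b \<le> (s' + l) * b"
      using that assms by (auto intro: mult_right_mono)
    then have "s' * b \<le> t * b" "t * b \<le> s' * b + l * b"
      by (auto simp: algebra_simps)
    then show ?thesis using s'b assms by (intro near_intI[of _ z]) linarith
  qed
  moreover have "s \<le> s'" by (simp add: s'_def)
  ultimately show ?thesis by blast
qed

text \<open>
  The starting phases of \<open>b\<close> that produce an overlap of length \<open>l\<close> with a window of \<open>a\<close> form, by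
  \<open>window_overlap\<close> with \<open>A = 2 * r / a\<close>, an arc of length \<open>2 * r + 2 * r * (b / a) - 2 * (l * b)\<close>. The
  starting phases at successive windows are an orbit of the rotation by \<open>b / a\<close>.
\<close>
lemma joint_window:
  fixes a b :: real and N :: nat and M :: int
  assumes pos: "0 < a" "0 < b" "0 \<le> r" "0 \<le> l" and l: "l * a \<le> 2 * r" "l * b \<le> 2 * r"
    and d: "0 < \<bar>of_nat N * (b / a) - of_int M\<bar>"
      "\<bar>of_nat N * (b / a) - of_int M\<bar> \<le> 2 * r + 2 * r * (b / a) - 2 * (l * b)"
  shows "\<exists>s>0. \<forall>t\<in>{s..s + l}. near_int r (x + t * a) \<and> near_int r (y + t * b)"
proof -
  obtain s0 where s0: "0 < s0" and win:
    "\<And>(k::nat) t. t \<in> {s0 + of_nat k / a .. s0 + of_nat k / a + 2 * r / a} \<Longrightarrow> near_int r (x + t * a)"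
    using periodic_windows[OF pos(1,3)] by blast
  define h where "h = - r - 2 * r * (b / a) + l * b"
  obtain k :: nat and z :: int where kz:
    "h \<le> (y + s0 * b) + of_nat k * (b / a) - of_int z"
    "(y + s0 * b) + of_nat k * (b / a) - of_int z \<le> r - l * b"
  proof -
    have "h + (2 * r + 2 * r * (b / a) - 2 * (l * b)) = r - l * b" by (simp add: h_def)
    with rotation_hits_arc[OF d, of h "y + s0 * b"] that show ?thesis by metis
  qed
  define s where "s = s0 + of_nat k / a"
  have sb: "y + s * b = (y + s0 * b) + of_nat k * (b / a)" by (simp add: s_def algebra_simps)
  have "\<exists>s'\<ge>s. s' + l \<le> s + 2 * r / a \<and> (\<forall>t\<in>{s'..s' + l}. near_int r (y + t * b))"
  proof (rule window_overlap[where z = z])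
    show "l \<le> 2 * r / a" using l pos by (simp add: field_simps)
    show "- r - 2 * r / a * b + l * b \<le> y + s * b - of_int z"
      "y + s * b - of_int z \<le> r - l * b"
      using kz unfolding sb by (auto simp: h_def)
  qed (use pos l in auto)
  then obtain s' where s': "s' \<ge> s" "s' + l \<le> s + 2 * r / a"
    "\<forall>t\<in>{s'..s' + l}. near_int r (y + t * b)" by blast
  have "0 \<le> of_nat k / a" using pos by simp
  then have "0 < s'" using s0 s'(1) by (simp add: s_def)
  moreover have "near_int r (x + t * a)" if "t \<in> {s'..s' + l}" for t
    using that s' by (intro win[of t k]) (auto simp: s_def)
  ultimately show ?thesis using s'(3) by blast
qed

text \<open>
  For overlaps of length \<open>0\<close> the arc has length \<open>1/3 + (b / a) / 3\<close>. This exceeds half a turn, which is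
  enough when \<open>b / a\<close> is not an integer; otherwise \<open>b / a \<ge> 2\<close> and the arc is the whole circle.
\<close>
lemma two_speeds:
  assumes "0 < a" "a < b"
  shows "\<exists>t>0. near_int (1/6) (x + t * a) \<and> near_int (1/6) (y + t * b)"
proof -
  have \<theta>: "b / a > 1" using assms by simp
  have "\<exists>(N::nat) (M::int). 0 < \<bar>of_nat N * (b / a) - of_int M\<bar> \<and>
      \<bar>of_nat N * (b / a) - of_int M\<bar> \<le> 1/3 + 1/3 * (b / a)"
  proof (cases "b / a \<in> \<int>")
    case True
    then obtain q :: int where "b / a = of_int q" by (auto elim: Ints_cases)
    with \<theta> have "b / a \<ge> 2" by simp
    then show ?thesis by (intro exI[of _ "0::nat"] exI[of _ "-1::int"]) simp
  next
    case False
    with nonint_rotation_step[OF this] \<theta> show ?thesis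
      by (intro exI[of _ "1::nat"] exI[of _ "round (b / a)"]) linarith
  qed
  then obtain N :: nat and M :: int where
    "0 < \<bar>of_nat N * (b / a) - of_int M\<bar>" 
    "\<bar>of_nat N * (b / a) - of_int M\<bar> \<le> 1/3 + 1/3 * (b / a)" by blast
  with joint_window[of a b "1/6" 0 N M x y] assms show ?thesis by auto
qed

section \<open>Three runners\<close>

text \<open>
  These phases are the two endpoints of the good arc of radius \<open>1/4\<close>, so half a turn exchanges them and
  does not spoil goodness.
\<close>
lemma near_quarter_if_double_half_odd:
  assumes "near_int 0 (2 * p - 1 / 2)"
  shows "near_int (1/4) p"
proof -
  obtain m :: int where m: "2 * p - 1 / 2 = of_int m"
    using assms by (auto simp: near_int_def)
  show ?thesis
  proof (cases "even m")
    case True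
    then obtain q where "m = 2 * q" by (elim evenE)
    with m show ?thesis by (intro near_intI[of _ q]) simp
  next
    case False
    then obtain q where "m = 2 * q + 1" by (elim oddE)
    with m show ?thesis by (intro near_intI[of _ "q + 1"]) simp
  qed
qed

lemma near_quarter_or_opposite: "near_int (1/4) p \<or> near_int (1/4) (p + 1 / 2)"
proof (cases "frac p \<le> 1/4 \<or> frac p \<ge> 3/4")
  case True
  have f: "p = of_int \<lfloor>p\<rfloor> + frac p" "0 \<le> frac p" "frac p < 1"
    using frac_lt_1[of p] frac_ge_0[of p] by (auto simp: frac_def)
  from True have "\<bar>p - of_int \<lfloor>p\<rfloor>\<bar> \<le> 1/4 \<or> \<bar>p - of_int (\<lfloor>p\<rfloor> + 1)\<bar> \<le> 1/4"
    using f by auto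
  then show ?thesis using near_intI by blast
next
  case False
  have "p + 1/2 - of_int (\<lfloor>p\<rfloor> + 1) = frac p - 1/2" by (simp add: frac_def)
  moreover have "\<bar>frac p - 1/2\<bar> \<le> 1/4" using False by linarith
  ultimately have "\<bar>p + 1/2 - of_int (\<lfloor>p\<rfloor> + 1)\<bar> \<le> 1/4" by simp
  then show ?thesis using near_intI by blast
qed

text \<open>
  Here half a period \<open>1 / (2 * u)\<close> moves the runner of speed \<open>2 * u\<close> by a full turn and the other two by
  half a turn, up to full turns. A window of \<open>2 * u\<close> is long enough to contain a time at which the
  runner of speed \<open>3 * u\<close> is at an endpoint of its good arc. That runner is then good both at this time
  and half a period later, and the slowest runner is good at one of the two.
\<close>
lemma speeds_one_two_three:
  assumes "0 < u"
  shows "\<exists>t>0. near_int (1/4) (x + t * u) \<and> near_int (1/4) (y + t * (2 * u)) \<and>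
    near_int (1/4) (z + t * (3 * u))"
proof -
  obtain s where s: "0 < s" and win:
    "\<And>(k::nat) t. t \<in> {s + of_nat k / (2*u) .. s + of_nat k / (2*u) + 2 * (1/4) / (2*u)}
      \<Longrightarrow> near_int (1/4) (y + t * (2*u))"
    using periodic_windows[of "2*u" "1/4" y] assms by auto
  \<comment> \<open>The endpoints \<open>\<plusminus>1/4\<close> are the points whose double is \<open>1/2\<close> modulo \<open>1\<close>.\<close>
  have "\<exists>t\<in>{s..s + 1 / (4*u)}. near_int 0 ((2 * z - 1/2) + t * (6*u))"
    using assms by (intro near_int_in_long_interval) auto
  then obtain t where t: "t \<in> {s..s + 1 / (4*u)}" 
    and t0: "near_int 0 ((2 * z - 1/2) + t * (6*u))" by blast
  define t' where "t' = t + 1 / (2*u)"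
  have t'u: "t' * u = t * u + 1/2" using assms by (simp add: t'_def field_simps)
  have y: "near_int (1/4) (y + t * (2*u))" using t by (intro win[of t 0]) auto
  have "y + t' * (2*u) = y + t * (2*u) + of_int 1" using t'u by simp
  with y have y': "near_int (1/4) (y + t' * (2*u))" by (simp only: near_int_add_int)
  have z: "near_int (1/4) (z + t * (3*u))"
    using t0 by (intro near_quarter_if_double_half_odd) (simp add: algebra_simps)
  have "near_int 0 ((2 * z - 1/2) + t * (6*u) + of_int 3)"
    using t0 by (simp only: near_int_add_int)
  also have "(2 * z - 1/2) + t * (6*u) + of_int 3 = 2 * (z + t' * (3*u)) - 1/2"
    using t'u by (simp add: algebra_simps)
  finally have z': "near_int (1/4) (z + t' * (3*u))"
    by (rule near_quarter_if_double_half_odd)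
  have "0 < t" "0 < t'" using t s assms by (auto simp: t'_def add_pos_pos)
  moreover have "near_int (1/4) (x + t * u) \<or> near_int (1/4) (x + t' * u)"
    using near_quarter_or_opposite[of "x + t * u"] t'u by (simp add: algebra_simps)
  ultimately show ?thesis using y y' z z' by blast
qed

text \<open>
  Waiting for multiples of the common period \<open>1 / u\<close> keeps the first two runners where they are and
  rotates the third by \<open>c / u\<close>; its good arc is half of the circle.
\<close>
lemma commensurable_pair_and_third:
  fixes u c :: real and m n :: int
  assumes "0 < u" "0 < s" "near_int (1/4) (x + s * (of_int m * u))"
    "near_int (1/4) (y + s * (of_int n * u))" "c / u \<notin> \<int>"
  shows "\<exists>t>0. near_int (1/4) (x + t * (of_int m * u)) \<and>
    near_int (1/4) (y + t * (of_int n * u)) \<and> near_int (1/4) (z + t * c)"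
proof -
  obtain k :: nat and i :: int where ki: 
    "- (1/4) \<le> (z + s * c) + of_nat k * (c / u) - of_int i"
    "(z + s * c) + of_nat k * (c / u) - of_int i \<le> - (1/4) + 1/2"
    using rotation_hits_arc[OF nonint_rotation_step[OF assms(5)], of "-(1/4)" "z + s * c"] by blast
  define t where "t = s + of_nat k / u"
  have tz: "z + t * c = (z + s * c) + of_nat k * (c / u)"
    by (simp add: t_def algebra_simps)
  have shift: "q + t * (of_int j * u) = q + s * (of_int j * u) + of_int (int k * j)" for q :: real and j :: int
    using assms(1) by (simp add: t_def field_simps)
  have "near_int (1/4) (x + t * (of_int m * u))" "near_int (1/4) (y + t * (of_int n * u))"
    using assms(3,4) unfolding shift near_int_add_int by auto
  moreover have "near_int (1/4) (z + t * c)"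
    using ki unfolding tz by (intro near_intI[of _ i]) linarith
  moreover have "0 < t" using assms(1,2) by (simp add: t_def add_pos_nonneg)
  ultimately show ?thesis by blast
qed

text \<open>
  Suppose that no good time exists. Then \<open>b / a\<close> generates no rotation by a nonzero amount of at most
  \<open>L\<close>, since \<open>joint_window\<close> would give an interval too long to be bad for \<open>c\<close>. This is used for three
  iterates: the empty one gives \<open>L < 1\<close>, the one nearest to a full turn gives \<open>\<epsilon> = 1 / N\<close>, and the
  first gives \<open>L < 1 / N\<close>, an upper bound for \<open>c / b\<close>.
\<close>
lemma three_speeds:
  assumes "0 < a" "a < b" "b < c"
  shows "\<exists>t>0. near_int (1/4) (x + t * a) \<and> near_int (1/4) (y + t * b) \<and>
    near_int (1/4) (z + t * c)"
proof (rule ccontr)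
  assume contra: "\<not> ?thesis"
  have pos: "0 < b" "0 < c" using assms by auto
  define \<epsilon> where "\<epsilon> = b / a - 1"
  define L where "L = 1 - b / c + \<epsilon> / 2"
  have \<epsilon>: "0 < \<epsilon>" using assms by (simp add: \<epsilon>_def)
  have g: "0 < b / c" "b / c < 1" using assms pos by auto
  have L_eq: "2 * (1/4) + 2 * (1/4) * (b / a) - 2 * (1 / (2*c) * b) = L"
    by (simp add: L_def \<epsilon>_def diff_divide_distrib)
  have miss: "\<not> (0 < \<bar>of_nat N * (b / a) - of_int M\<bar> \<and> \<bar>of_nat N * (b / a) - of_int M\<bar> \<le> L)"
    for N :: nat and M :: int
  proof
    assume NM: "0 < \<bar>of_nat N * (b / a) - of_int M\<bar> \<and> \<bar>of_nat N * (b / a) - of_int M\<bar> \<le> L"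
    have "\<exists>s>0. \<forall>t\<in>{s..s + 1 / (2*c)}. near_int (1/4) (x + t * a) \<and> near_int (1/4) (y + t * b)"
    proof (rule joint_window[where N = N and M = M])
      show "1 / (2*c) * a \<le> 2 * (1/4)" "1 / (2*c) * b \<le> 2 * (1/4)"
        using assms pos by (auto simp: field_simps)
      show "\<bar>of_nat N * (b / a) - of_int M\<bar> \<le> 2 * (1/4) + 2 * (1/4) * (b / a) - 2 * (1 / (2*c) * b)"
        using NM unfolding L_eq by blast
    qed (use assms pos NM in auto)
    then obtain s where s: "0 < s"
      "\<forall>t\<in>{s..s + 1 / (2*c)}. near_int (1/4) (x + t * a) \<and> near_int (1/4) (y + t * b)" by blast
    have "\<exists>t\<in>{s..s + 1 / (2*c)}. near_int (1/4) (z + t * c)"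
      using pos by (intro near_int_in_long_interval) auto
    with s contra show False by force
  qed
  \<comment> \<open>This bound makes the integer nearest to \<open>1 / \<epsilon>\<close> positive.\<close>
  have "\<epsilon> < 2"
  proof -
    have "\<not> 1 \<le> L" using miss[of 0 "-1"] by simp
    then show ?thesis using g unfolding L_def by linarith
  qed
  define N where "N = nat (round (1 / \<epsilon>))"
  have "1 / \<epsilon> > 1/2" using \<epsilon> \<open>\<epsilon> < 2\<close> by (simp add: field_simps)
  then have N1: "1 \<le> N" and N: "\<bar>of_nat N - 1 / \<epsilon>\<bar> \<le> 1/2"
    using of_int_round_abs_le[of "1 / \<epsilon>"] unfolding N_def by linarith+
  have eq: "of_nat N * (b / a) - of_int (int N + 1) = \<epsilon> * (of_nat N - 1 / \<epsilon>)"
  proof -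
    have "\<epsilon> * (of_nat N - 1 / \<epsilon>) = of_nat N * \<epsilon> - 1"
      using \<epsilon> by (simp add: right_diff_distrib)
    then show ?thesis by (simp add: \<epsilon>_def right_diff_distrib)
  qed
  have "\<bar>\<epsilon> * (of_nat N - 1 / \<epsilon>)\<bar> \<le> \<epsilon> * (1/2)"
    using N \<epsilon> by (simp add: abs_mult)
  also have "\<dots> \<le> L" using g by (simp add: L_def)
  finally have "of_nat N = 1 / \<epsilon>"
    using miss[of N "int N + 1"] \<epsilon> unfolding eq by auto
  then have \<epsilon>N: "\<epsilon> = 1 / of_nat N" using \<epsilon> N1 by (simp add: field_simps)
  have "of_nat 1 * (b / a) - of_int 1 = \<epsilon>" by (simp add: \<epsilon>_def)
  then have "L < \<epsilon>" using miss[of 1 1] \<epsilon> by auto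
  then have gN: "1 - b / c < 1 / (2 * of_nat N)" by (simp add: L_def \<epsilon>N)
  define u where "u = a / of_nat N"
  have u: "0 < u" using assms N1 by (simp add: u_def)
  have a: "a = of_int (int N) * u" using N1 by (simp add: u_def)
  have "b = a * (1 + \<epsilon>)" using assms by (simp add: \<epsilon>_def)
  then have b: "b = of_int (int N + 1) * u" using N1 by (simp add: \<epsilon>N u_def field_simps)
  \<comment> \<open>Overlaps of length \<open>0\<close> have an arc of length above \<open>1\<close>, hence always occur.\<close>
  obtain s where s: "0 < s" "near_int (1/4) (x + s * a)" "near_int (1/4) (y + s * b)"
  proof -
    have "1 \<le> 1/2 + b / (2 * a)" using assms by (simp add: field_simps)
    then show ?thesis
      using joint_window[of a b "1/4" 0 0 "-1" x y] assms pos that by auto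
  qed
  have "c / u \<in> \<int>"
  proof (rule ccontr)
    assume "c / u \<notin> \<int>"
    with commensurable_pair_and_third[of u s x "int N" y "int N + 1" c z] s u contra
    show False unfolding a b by blast
  qed
  then obtain C :: int where "c / u = of_int C" by (auto elim: Ints_cases)
  then have c: "c = of_int C * u" using u by (simp add: field_simps)
  have "of_int (int N + 1) * u < of_int C * u" using assms(3) unfolding b c .
  then have C: "int N + 1 < C" using u by (simp only: mult_less_cancel_right_pos of_int_less_iff)
  have "1 - real_of_int (int N + 1) / real_of_int C < 1 / (2 * real N)"
    using gN u unfolding b c by simp
  then have "real_of_int (C * (2 * int N - 1)) < real_of_int (2 * int N * (int N + 1))"
    using C N1 by (simp add: field_simps)
  then have C2: "C * (2 * int N - 1) < 2 * int N * (int N + 1)" by linarith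
  \<comment> \<open>\<open>C \<ge> N + 2\<close> turns the bound into a quadratic inequality in \<open>N\<close> alone.\<close>
  have "(int N + 2) * (2 * int N - 1) \<le> C * (2 * int N - 1)"
    using C N1 by (intro mult_right_mono) auto
  with C2 have "int N < 2" by (simp add: algebra_simps)
  with N1 have "N = 1" by simp
  with C C2 have "C = 3" by simp
  with speeds_one_two_three[OF u, of x y z] contra \<open>N = 1\<close> show False
    unfolding a b c by simp
qed

section \<open>From phases to runners\<close>

text \<open>
  Two representatives in \<open>[0,1)\<close> differ by the difference of the real positions up to an integer, and as
  their difference lies in \<open>(-1,1)\<close>, it is \<open>1/2 + e\<close> or \<open>-1/2 + e\<close>, where \<open>e\<close> is the distance of the
  phase to its nearest integer, with sign. The interval \<open>[1/n, 1 - 1/n]\<close> treats both alike.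
\<close>
lemma runner_distance:
  assumes "2 \<le> n"
    and "near_int (1/2 - 1 / real n) ((x - y - 1/2) + t * (v - w))"
  shows "\<bar>runner x v t - runner y w t\<bar> \<in> {1 / real n .. 1 - 1 / real n}"
proof -
  obtain z :: int where z: "\<bar>(x - y - 1/2) + t * (v - w) - of_int z\<bar> \<le> 1/2 - 1 / real n"
    using assms(2) by (auto simp: near_int_def)
  define e where "e = (x - y - 1/2) + t * (v - w) - of_int z"
  define m where "m = z - \<lfloor>x + t * v\<rfloor> + \<lfloor>y + t * w\<rfloor>"
  have D: "runner x v t - runner y w t = of_int m + 1/2 + e"
    by (simp add: runner_def frac_def m_def e_def algebra_simps)
  have "runner x v t - runner y w t < 1" "- 1 < runner x v t - runner y w t"
    using frac_lt_1[of "x + t * v"] frac_ge_0[of "x + t * v"]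
      frac_lt_1[of "y + t * w"] frac_ge_0[of "y + t * w"] unfolding runner_def by linarith+
  moreover have e: "\<bar>e\<bar> \<le> 1/2 - 1 / real n" using z by (simp add: e_def)
  moreover have n: "0 < 1 / real n" using assms by simp
  ultimately have "of_int m < (1::real)" "- 2 < real_of_int m" using D by linarith+
  then have "m = 0 \<or> m = - 1" by linarith
  then show ?thesis using D e n by auto
qed

lemma three_elements_sorted:
  fixes f :: "'a \<Rightarrow> 'b::linorder"
  assumes "card S = 3" "inj_on f S"
  obtains p q r where "S = {p, q, r}" "f p < f q" "f q < f r"
proof -
  obtain p q r where S: "S = {p, q, r}" "p \<noteq> q" "q \<noteq> r" "p \<noteq> r"
    using assms(1) by (auto simp: card_3_iff)
  have "f p \<noteq> f q" "f q \<noteq> f r" "f p \<noteq> f r" using assms(2) S by (auto simp: inj_on_def)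
  then consider "f p < f q" "f q < f r" | "f p < f r" "f r < f q" | "f q < f p" "f p < f r"
    | "f q < f r" "f r < f p" | "f r < f p" "f p < f q" | "f r < f q" "f q < f p"
    by (meson linorder_neqE)
  then show ?thesis
    by cases (use that S(1) in blast)+
qed

lemma lonely_time:
  fixes x w :: "nat \<Rightarrow> real"
  assumes "n \<in> {2, 3, 4}" "card S = n - 1"
    and w: "\<And>j. j \<in> S \<Longrightarrow> w j > 0" and inj: "inj_on w S"
  shows "\<exists>t>0. \<forall>j\<in>S. near_int (1/2 - 1 / real n) (x j + t * w j)"
proof -
  consider "n = 2" | "n = 3" | "n = 4" using assms(1) by auto
  then show ?thesis
  proof cases
    case 1
    with assms(2) obtain p where S: "S = {p}" by (auto simp: card_1_singleton_iff)
    with w have p: "w p > 0" by simp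
    obtain t where "t \<in> {1..1 + 1 / w p}" "near_int 0 (x p + t * w p)"
      using near_int_in_long_interval[of "w p" "1 / w p" 0 1 "x p"] p by auto
    then show ?thesis using 1 S by (intro exI[of _ t]) auto
  next
    case 2
    with assms(2) obtain p q where S: "S = {p, q}" "p \<noteq> q" by (auto simp: card_2_iff)
    with inj have "w p \<noteq> w q" by simp
    then obtain p q where S: "S = {p, q}" and "w p < w q"
      using S by (metis insert_commute linorder_neqE)
    with two_speeds[of "w p" "w q" "x p" "x q"] w show ?thesis using 2 by auto
  next
    case 3
    with assms(2) have "card S = 3" by simp
    from three_elements_sorted[OF this inj] obtain p q r
      where S: "S = {p, q, r}" "w p < w q" "w q < w r" by blast
    with three_speeds[of "w p" "w q" "w r" "x p" "x q" "x r"] w show ?thesis using 3 by auto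
  qed
qed

theorem theorem3:
  fixes n :: nat
  assumes "n \<in> {2, 3, 4}"
  shows "lonely_runner_free_start n"
  unfolding lonely_runner_free_start_def
proof (intro allI impI ballI, elim conjE)
  fix v xbar :: "nat \<Rightarrow> real" and i :: nat
  assume i: "i \<in> {1..n}"
    and pos: "\<forall>j\<in>{1..n} - {i}. 0 < \<bar>v j - v i\<bar>"
    and inj: "inj_on (\<lambda>j. \<bar>v j - v i\<bar>) ({1..n} - {i})"
  define S where "S = {1..n} - {i}"
  have "card S = n - 1" using i by (simp add: S_def)
  then obtain t where t: "t > 0" and near: "\<forall>j\<in>S. near_int (1/2 - 1 / real n)
      (sgn (v j - v i) * (xbar j - xbar i - 1/2) + t * \<bar>v j - v i\<bar>)"
    using lonely_time[of n S "\<lambda>j. \<bar>v j - v i\<bar>" 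
        "\<lambda>j. sgn (v j - v i) * (xbar j - xbar i - 1/2)"] assms pos inj
    by (auto simp: S_def)
  have "\<bar>runner (xbar j) (v j) t - runner (xbar i) (v i) t\<bar> \<in> {1 / real n .. 1 - 1 / real n}"
    if "j \<in> S" for j
  proof (rule runner_distance)
    show "2 \<le> n" using assms by auto
    show "near_int (1/2 - 1 / real n) ((xbar j - xbar i - 1/2) + t * (v j - v i))"
      by (rule near_int_abs_speed) (use near pos that in \<open>auto simp: S_def\<close>)
  qed
  with t show "\<exists>t>0. \<forall>j\<in>{1..n} - {i}.
      \<bar>runner (xbar j) (v j) t - runner (xbar i) (v i) t\<bar> \<in> {1 / real n .. 1 - 1 / real n}"
    unfolding S_def by blast
qed

end
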